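(* Let $G$ be an abelian group, $X$ a compact Hausdorff space and $s:G\to\mathrm{Aut}(X)$ a topological dynamical system. Then for each integer $i\ge 0$, the skew group ring $B_i\rtimes^\sigma G$ is simple if and only if $s$ is minimal and faithful.
   Context: Rings are not necessarily associative. A ring is simple if it has no (two-sided) ideals other than $\{0\}$ and itself. $\mathrm{Aut}(X)$ is the group of homeomorphisms of $X$, and a topological dynamical system is a group homomorphism $s:G\to\mathrm{Aut}(X)$. A subset $Y\subseteq X$ is $G$-invariant if $s(g)(Y)\subseteq Y$ for all $g\in G$. $s$ is minimal if there is no closed non-empty proper $G$-invariant subset of $X$. $s$ is faithful if for each non-identity $g\in G$ there is $x\in X$ with $s(g)(x)\ne x$. Cayley-Dickson algebras: $C_0=\mathbb R$ with trivial involution, and $C_{n+1}=\{a+bu: a,b\in C_n\}$ with product $(a+bu)(c+du)=(ac-\overline d\,b)+(da+b\,\overline c)u$ and involution $\overline{a+bu}=\overline a-bu$ (so $C_1=\mathbb C$, $C_2=\mathbb H$, $C_3=\mathbb O$, $C_4=\mathbb S$, etc.). For $i\ge 0$, $B_i$ is the algebra of continuous $C_i$-valued functions on $X$ with pointwise addition and multiplication ($C_i$ having its usual norm topology as a finite-dimensional real vector space). $s$ induces a group homomorphism $\sigma:G\to\mathrm{Aut}(B_i)$ by $\sigma_g(f)(x)=f(s(g^{-1})(x))$ for $g\in G$, $f\in B_i$, $x\in X$. The skew group ring $B_i\rtimes^\sigma G$ is the set of formal sums $\sum_{g\in G}f_gu_g$ with $f_g\in B_i$, all but finitely many zero, with pointwise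 addition and multiplication given by the biadditive extension of $(au_g)(bu_h)=a\sigma_g(b)u_{gh}$ for $a,b\in B_i$, $g,h\in G$. *)

theory Defs
  imports "HOL-Analysis.Analysis" "HOL-Algebra.AbelCoset"
begin

text \<open>
  Rings are not assumed associative, so the locales \<open>ring\<close> and \<open>ideal\<close> of HOL-Algebra do not
  apply.  Only its record type of rings, which carries no axioms, and its notion of additive
  subgroup are used.
\<close>

definition two_sided_ideal :: "'a set \<Rightarrow> ('a, 'm) ring_scheme \<Rightarrow> bool" where
  "two_sided_ideal I R \<longleftrightarrow>
     additive_subgroup I R \<and>
     (\<forall>a\<in>I. \<forall>x\<in>carrier R. x \<otimes>\<^bsub>R\<^esub> a \<in> I \<and> a \<otimes>\<^bsub>R\<^esub> x \<in> I)"

definition simple_nonassoc_ring :: "('a, 'm) ring_scheme \<Rightarrow> bool" where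
  "simple_nonassoc_ring R \<longleftrightarrow>
     (\<forall>I. two_sided_ideal I R \<longrightarrow> I = {\<zero>\<^bsub>R\<^esub>} \<or> I = carrier R)"

definition homeo_group :: "('x::topological_space \<Rightarrow> 'x) monoid" where
  "homeo_group =
     \<lparr>carrier = {f. \<exists>g. homeomorphism UNIV UNIV f g}, mult = (\<circ>), one = id\<rparr>"

definition invariant_subset ::
    "('g, 'm) monoid_scheme \<Rightarrow> ('g \<Rightarrow> 'x \<Rightarrow> 'x) \<Rightarrow> 'x set \<Rightarrow> bool" where
  "invariant_subset G s Y \<longleftrightarrow> (\<forall>g\<in>carrier G. s g ` Y \<subseteq> Y)"

definition minimal_system ::
    "('g, 'm) monoid_scheme \<Rightarrow> ('g \<Rightarrow> 'x::topological_space \<Rightarrow> 'x) \<Rightarrow> bool" where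
  "minimal_system G s \<longleftrightarrow>
     \<not> (\<exists>Y. closed Y \<and> Y \<noteq> {} \<and> Y \<noteq> UNIV \<and> invariant_subset G s Y)"

definition faithful_system ::
    "('g, 'm) monoid_scheme \<Rightarrow> ('g \<Rightarrow> 'x \<Rightarrow> 'x) \<Rightarrow> bool" where
  "faithful_system G s \<longleftrightarrow> (\<forall>g\<in>carrier G. g \<noteq> \<one>\<^bsub>G\<^esub> \<longrightarrow> (\<exists>x. s g x \<noteq> x))"

text \<open>
  The algebra \<open>C\<^sub>n\<close> has real dimension \<open>2^n\<close>.  So that all of them live in one type, an element of
  \<open>C\<^sub>n\<close> is represented by its coordinate sequence, which vanishes from index \<open>2^n\<close> on; the carrier
  is that of \<^const>\<open>Euclidean_space\<close> \<open>(2^n)\<close>.  The element \<open>a + bu\<close> of \<open>C\<^sub>n\<^sub>+\<^sub>1\<close> is the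
  concatenation \<open>cd_pair n a b\<close> of the first \<open>2^n\<close> coordinates of \<open>a\<close> and the coordinates of \<open>b\<close>.
\<close>

definition cd_pair :: "nat \<Rightarrow> (nat \<Rightarrow> real) \<Rightarrow> (nat \<Rightarrow> real) \<Rightarrow> nat \<Rightarrow> real" where
  "cd_pair n a b = (\<lambda>k. if k < 2 ^ n then a k else b (k - 2 ^ n))"

definition cd_fst :: "nat \<Rightarrow> (nat \<Rightarrow> real) \<Rightarrow> nat \<Rightarrow> real" where
  "cd_fst n x = (\<lambda>k. if k < 2 ^ n then x k else 0)"

definition cd_snd :: "nat \<Rightarrow> (nat \<Rightarrow> real) \<Rightarrow> nat \<Rightarrow> real" where
  "cd_snd n x = (\<lambda>k. if k < 2 ^ n then x (k + 2 ^ n) else 0)"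

fun cd_conj :: "nat \<Rightarrow> (nat \<Rightarrow> real) \<Rightarrow> nat \<Rightarrow> real" where
  "cd_conj 0 x = x"
| "cd_conj (Suc n) x = cd_pair n (cd_conj n (cd_fst n x)) (\<lambda>k. - cd_snd n x k)"

fun cd_mult :: "nat \<Rightarrow> (nat \<Rightarrow> real) \<Rightarrow> (nat \<Rightarrow> real) \<Rightarrow> nat \<Rightarrow> real" where
  "cd_mult 0 x y = (\<lambda>k. if k = 0 then x 0 * y 0 else 0)"
| "cd_mult (Suc n) x y =
     (let a = cd_fst n x; b = cd_snd n x; c = cd_fst n y; d = cd_snd n y in
      cd_pair n
        (\<lambda>k. cd_mult n a c k - cd_mult n (cd_conj n d) b k)
        (\<lambda>k. cd_mult n d a k + cd_mult n b (cd_conj n c) k))"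

definition cayley_dickson :: "nat \<Rightarrow> (nat \<Rightarrow> real) ring" where
  "cayley_dickson n =
     \<lparr>carrier = topspace (Euclidean_space (2 ^ n)),
      mult = cd_mult n,
      one = (\<lambda>k. if k = 0 then 1 else 0),
      zero = (\<lambda>k. 0),
      add = (\<lambda>a b k. a k + b k)\<rparr>"

definition cd_functions :: "nat \<Rightarrow> ('x::topological_space \<Rightarrow> nat \<Rightarrow> real) ring" where
  "cd_functions i =
     \<lparr>carrier = {f. continuous_map euclidean (Euclidean_space (2 ^ i)) f},
      mult = (\<lambda>f h x. f x \<otimes>\<^bsub>cayley_dickson i\<^esub> h x),
      one = (\<lambda>x. \<one>\<^bsub>cayley_dickson i\<^esub>),
      zero = (\<lambda>x. \<zero>\<^bsub>cayley_dickson i\<^esub>),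
      add = (\<lambda>f h x. f x \<oplus>\<^bsub>cayley_dickson i\<^esub> h x)\<rparr>"

definition induced_action ::
    "('g, 'm) monoid_scheme \<Rightarrow> ('g \<Rightarrow> 'x \<Rightarrow> 'x) \<Rightarrow> 'g \<Rightarrow> ('x \<Rightarrow> 'c) \<Rightarrow> 'x \<Rightarrow> 'c" where
  "induced_action G s g f = (\<lambda>x. f (s (inv\<^bsub>G\<^esub> g) x))"

text \<open>
  The formal sum of the \<open>f\<^sub>g u\<^sub>g\<close> is the coefficient function \<open>g \<mapsto> f\<^sub>g\<close>, set to zero outside the
  carrier of the group.  The coefficient of a product at \<open>k\<close> sums \<open>f\<^sub>g \<sigma>\<^sub>g(f'\<^sub>h)\<close> over the pairs with
  \<open>gh = k\<close>; restricting these to the supports makes the index set finite and drops only zero terms.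
\<close>

definition skew_group_ring ::
    "('b, 'n) ring_scheme \<Rightarrow> ('g, 'm) monoid_scheme \<Rightarrow> ('g \<Rightarrow> 'b \<Rightarrow> 'b) \<Rightarrow> ('g \<Rightarrow> 'b) ring" where
  "skew_group_ring B G \<sigma> =
     \<lparr>carrier = {F. (\<forall>g\<in>carrier G. F g \<in> carrier B) \<and> (\<forall>g. g \<notin> carrier G \<longrightarrow> F g = \<zero>\<^bsub>B\<^esub>) \<and>
                    finite {g. F g \<noteq> \<zero>\<^bsub>B\<^esub>}},
      mult = (\<lambda>F F' k. \<Oplus>\<^bsub>B\<^esub>p \<in> {(g, h). g \<in> carrier G \<and> h \<in> carrier G \<and>
                                     F g \<noteq> \<zero>\<^bsub>B\<^esub> \<and> F' h \<noteq> \<zero>\<^bsub>B\<^esub> \<and> g \<otimes>\<^bsub>G\<^esub> h = k}.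
                F (fst p) \<otimes>\<^bsub>B\<^esub> \<sigma> (fst p) (F' (snd p))),
      one = (\<lambda>g. if g = \<one>\<^bsub>G\<^esub> then \<one>\<^bsub>B\<^esub> else \<zero>\<^bsub>B\<^esub>),
      zero = (\<lambda>g. \<zero>\<^bsub>B\<^esub>),
      add = (\<lambda>F F' g. F g \<oplus>\<^bsub>B\<^esub> F' g)\<rparr>"

end

theory Submission
  imports Defs
begin

text \<open>
  If \<open>s\<close> is minimal and faithful, then it is free, because the fixed point set of \<open>s g\<close> is closed
  and, \<open>G\<close> being abelian, invariant.  A nonzero ideal contains an \<open>F\<close> with \<open>F \<one> z \<noteq> 0\<close> for some
  \<open>z\<close>, and by freeness there is a real-valued \<open>p\<close> with \<open>p z = 1\<close> whose support near \<open>z\<close> is so small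
  that \<open>p (F p) = p\<^sup>2 F\<^sub>\<one> u\<^sub>\<one>\<close>.  So the ideal contains some \<open>f u\<^sub>\<one>\<close> with \<open>f \<noteq> 0\<close>.  In every
  Cayley-Dickson algebra \<open>x\<close> times its conjugate is the real number \<open>\<bar>x\<bar>\<^sup>2\<close>; hence the ideal contains
  \<open>\<bar>f\<bar>\<^sup>2 u\<^sub>\<one>\<close> and its translates.  By minimality and compactness finitely many translates have a
  nowhere vanishing sum, which is invertible.  All scalars used are real, so the lack of
  associativity does no harm.

  Conversely, a closed invariant set \<open>Y\<close> yields the ideal of those \<open>F\<close> whose coefficients vanish
  on \<open>Y\<close>, and an element \<open>g\<close> acting trivially yields the ideal of all \<open>F - F u\<^sub>g\<close>.
\<close>

section \<open>Cayley-Dickson multiplication\<close>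

text \<open>The copy of the reals in every \<open>C\<^sub>n\<close>. It is the same sequence at each
  level, so \<open>cd_fst\<close> and the conjugations fix it.\<close>

definition cd_real :: "real \<Rightarrow> nat \<Rightarrow> real" where
  "cd_real r = (\<lambda>k. if k = 0 then r else 0)"

definition cd_normsq :: "nat \<Rightarrow> (nat \<Rightarrow> real) \<Rightarrow> real" where
  "cd_normsq n x = (\<Sum>k<2 ^ n. (x k)\<^sup>2)"

lemma cd_real_zero [simp]: "cd_real 0 = (\<lambda>k. 0)"
  by (simp add: cd_real_def)

lemma cd_fst_zero [simp]: "cd_fst n (\<lambda>k. 0) = (\<lambda>k. 0)"
  by (simp add: cd_fst_def)

lemma cd_snd_zero [simp]: "cd_snd n (\<lambda>k. 0) = (\<lambda>k. 0)"
  by (simp add: cd_snd_def)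

lemma cd_pair_zero [simp]: "cd_pair n (\<lambda>k. 0) (\<lambda>k. 0) = (\<lambda>k. 0)"
  by (simp add: cd_pair_def)

lemma cd_fst_real [simp]: "cd_fst n (cd_real r) = cd_real r"
  by (auto simp: cd_fst_def cd_real_def)

lemma cd_snd_real [simp]: "cd_snd n (cd_real r) = (\<lambda>k. 0)"
  by (auto simp: cd_snd_def cd_real_def)

lemma cd_pair_real [simp]: "cd_pair n (cd_real r) (\<lambda>k. 0) = cd_real r"
  by (auto simp: cd_pair_def cd_real_def)

lemma cd_fst_support: "k \<ge> 2 ^ n \<Longrightarrow> cd_fst n x k = 0"
  by (simp add: cd_fst_def)

lemma cd_snd_support: "k \<ge> 2 ^ n \<Longrightarrow> cd_snd n x k = 0"
  by (simp add: cd_snd_def)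

lemma cd_fst_pair:
  "(\<And>k. k \<ge> 2 ^ n \<Longrightarrow> a k = 0) \<Longrightarrow> cd_fst n (cd_pair n a b) = a"
  by (auto simp: cd_fst_def cd_pair_def)

lemma cd_snd_pair:
  "(\<And>k. k \<ge> 2 ^ n \<Longrightarrow> b k = 0) \<Longrightarrow> cd_snd n (cd_pair n a b) = b"
  by (auto simp: cd_snd_def cd_pair_def)

lemma cd_pair_fst_snd:
  "(\<And>k. k \<ge> 2 ^ Suc n \<Longrightarrow> x k = 0) \<Longrightarrow> cd_pair n (cd_fst n x) (cd_snd n x) = x"
  by (auto simp: cd_snd_def cd_fst_def cd_pair_def)

section \<open>Additivity and real scalars\<close>

lemma cd_fst_diff: "cd_fst n (\<lambda>k. x k - y k) = (\<lambda>k. cd_fst n x k - cd_fst n y k)"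
  by (auto simp: cd_fst_def)

lemma cd_snd_diff: "cd_snd n (\<lambda>k. x k - y k) = (\<lambda>k. cd_snd n x k - cd_snd n y k)"
  by (auto simp: cd_snd_def)

lemma cd_conj_diff: "cd_conj n (\<lambda>k. x k - y k) = (\<lambda>k. cd_conj n x k - cd_conj n y k)"
  by (induction n arbitrary: x y) (auto simp: cd_fst_diff cd_snd_diff cd_pair_def)

lemma cd_conj_zero [simp]: "cd_conj n (\<lambda>k. 0) = (\<lambda>k. 0)"
  by (induction n) auto

lemma cd_conj_real [simp]: "cd_conj n (cd_real r) = cd_real r"
  by (induction n) simp_all

lemma cd_conj_support:
  "(\<And>k. k \<ge> 2 ^ n \<Longrightarrow> x k = 0) \<Longrightarrow> k \<ge> 2 ^ n \<Longrightarrow> cd_conj n x k = 0"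
  by (induction n arbitrary: x k) (auto simp: cd_pair_def cd_snd_def)

lemma cd_mult_support: "k \<ge> 2 ^ n \<Longrightarrow> cd_mult n x y k = 0"
  by (induction n arbitrary: x y k) (auto simp: cd_pair_def Let_def)

text \<open>Both arguments are handled in one induction because the recursive formula swaps factors:
  the component \<open>b\<close> of the left argument stands on the right in the product of the
  conjugate of \<open>d\<close> with \<open>b\<close>. Differences suffice, since the rules for zero
  and negation are special cases.\<close>

lemma cd_mult_diff:
  "cd_mult n (\<lambda>k. x k - y k) z = (\<lambda>k. cd_mult n x z k - cd_mult n y z k)"
  "cd_mult n z (\<lambda>k. x k - y k) = (\<lambda>k. cd_mult n z x k - cd_mult n z y k)"
proof (induction n arbitrary: x y z)
  case 0
  { case 1 show ?case by (auto simp: algebra_simps) }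
  { case 2 show ?case by (auto simp: algebra_simps) }
next
  case (Suc n)
  { case 1 show ?case
      by (auto simp: Let_def cd_fst_diff cd_snd_diff cd_conj_diff Suc cd_pair_def) }
  { case 2 show ?case
      by (auto simp: Let_def cd_fst_diff cd_snd_diff cd_conj_diff Suc cd_pair_def) }
qed

lemma cd_mult_zero [simp]:
  "cd_mult n (\<lambda>k. 0) z = (\<lambda>k. 0)" "cd_mult n z (\<lambda>k. 0) = (\<lambda>k. 0)"
  using cd_mult_diff(1)[of n "\<lambda>k. 0" "\<lambda>k. 0" z] cd_mult_diff(2)[of n z "\<lambda>k. 0" "\<lambda>k. 0"]
  by simp_all

lemma cd_mult_minus:
  "cd_mult n (\<lambda>k. - x k) z = (\<lambda>k. - cd_mult n x z k)"
  "cd_mult n z (\<lambda>k. - x k) = (\<lambda>k. - cd_mult n z x k)"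
  using cd_mult_diff(1)[of n "\<lambda>k. 0" x z] cd_mult_diff(2)[of n z "\<lambda>k. 0" x]
  by simp_all

text \<open>Scalars are central: conjugation fixes them and their second component is zero, so the
  recursion reduces to scalar products of the components. The truncation keeps the formula true for
  sequences \<open>y\<close> with entries beyond \<open>2 ^ n\<close>.\<close>

lemma cd_mult_real:
  "cd_mult n (cd_real r) y = (\<lambda>k. if k < 2 ^ n then r * y k else 0)"
  "cd_mult n y (cd_real r) = (\<lambda>k. if k < 2 ^ n then r * y k else 0)"
proof (induction n arbitrary: y)
  case 0
  { case 1 show ?case by (auto simp: cd_real_def) }
  { case 2 show ?case by (auto simp: cd_real_def) }
next
  case (Suc n)
  { case 1 show ?case
      by (simp add: Let_def Suc) (auto simp: fun_eq_iff cd_pair_def cd_fst_def cd_snd_def) }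
  { case 2 show ?case
      by (simp add: Let_def Suc) (auto simp: fun_eq_iff cd_pair_def cd_fst_def cd_snd_def) }
qed

section \<open>Conjugation and the norm\<close>

lemma cd_conj_conj:
  "(\<And>k. k \<ge> 2 ^ n \<Longrightarrow> x k = 0) \<Longrightarrow> cd_conj n (cd_conj n x) = x"
proof (induction n arbitrary: x)
  case (Suc n)
  have "cd_fst n (cd_conj (Suc n) x) = cd_conj n (cd_fst n x)"
    using cd_fst_pair[OF cd_conj_support] by (simp add: cd_fst_support)
  moreover have "cd_snd n (cd_conj (Suc n) x) = (\<lambda>k. - cd_snd n x k)"
    by (simp add: cd_snd_pair cd_snd_support)
  ultimately show ?case
    using Suc cd_pair_fst_snd[of n x] by (simp add: cd_fst_support)
qed auto

lemma cd_normsq_Suc: "cd_normsq (Suc n) x = cd_normsq n (cd_fst n x) + cd_normsq n (cd_snd n x)"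
proof -
  have "(\<Sum>k<2 ^ Suc n. (x k)\<^sup>2) = (\<Sum>k<2 ^ n. (x k)\<^sup>2) + (\<Sum>k=2 ^ n..<2 ^ n + 2 ^ n. (x k)\<^sup>2)"
    by (subst lessThan_atLeast0 [symmetric] sum.atLeastLessThan_concat [symmetric])
       (auto simp: lessThan_atLeast0 mult_2 sum.atLeastLessThan_concat)
  also have "(\<Sum>k=2 ^ n..<2 ^ n + 2 ^ n. (x k)\<^sup>2) = (\<Sum>k<2 ^ n. (x (k + 2 ^ n))\<^sup>2)"
    using sum.shift_bounds_nat_ivl[of "\<lambda>k. (x k)\<^sup>2" 0 "2 ^ n" "2 ^ n"]
    by (simp add: lessThan_atLeast0)
  finally show ?thesis
    by (simp add: cd_normsq_def cd_fst_def cd_snd_def)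
qed

text \<open>For \<open>x = a + b u\<close> the conjugate is \<open>conj a - b u\<close>. The product
  formula gives \<open>a (conj a) + (conj b) b\<close> as first component and
  \<open>- b a + b (conj (conj a)) = 0\<close> as second. Both orders of multiplication occur one
  level down, so the two identities are proved together.\<close>

lemma cd_mult_conj:
  "(\<And>k. k \<ge> 2 ^ n \<Longrightarrow> x k = 0) \<Longrightarrow> cd_mult n x (cd_conj n x) = cd_real (cd_normsq n x)"
  "(\<And>k. k \<ge> 2 ^ n \<Longrightarrow> x k = 0) \<Longrightarrow> cd_mult n (cd_conj n x) x = cd_real (cd_normsq n x)"
proof (induction n arbitrary: x)
  case 0
  { case 1 show ?case by (auto simp: cd_real_def cd_normsq_def power2_eq_square) }
  { case 2 show ?case by (auto simp: cd_real_def cd_normsq_def power2_eq_square) }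
next
  case (Suc n)
  have f: "cd_fst n (cd_conj (Suc n) x) = cd_conj n (cd_fst n x)" for x
    using cd_fst_pair[OF cd_conj_support] by (simp add: cd_fst_support)
  have s: "cd_snd n (cd_conj (Suc n) x) = (\<lambda>k. - cd_snd n x k)" for x
    by (simp add: cd_snd_pair cd_snd_support)
  have m: "cd_conj n (\<lambda>k. - cd_snd n x k) = (\<lambda>k. - cd_conj n (cd_snd n x) k)" for x
    using cd_conj_diff[of n "\<lambda>k. 0" "cd_snd n x"] by simp
  note IH = Suc(1,2)[OF cd_fst_support] Suc(1,2)[OF cd_snd_support]
  have p: "cd_pair n (\<lambda>k. cd_real a k + cd_real b k) (\<lambda>k. 0) = cd_real (a + b)" for a b
    by (auto simp: cd_pair_def cd_real_def)
  { case 1 show ?case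
      unfolding cd_mult.simps f s Let_def m
      by (simp add: IH cd_mult_minus cd_conj_conj cd_fst_support cd_normsq_Suc p
            del: cd_conj.simps) }
  { case 2 show ?case
      unfolding cd_mult.simps f s Let_def m
      by (simp add: IH cd_mult_minus cd_conj_conj cd_fst_support cd_normsq_Suc p
            del: cd_conj.simps) }
qed

lemma cd_normsq_pos: "k < 2 ^ n \<Longrightarrow> x k \<noteq> 0 \<Longrightarrow> cd_normsq n x > 0"
  unfolding cd_normsq_def by (rule sum_pos2[where i = k]) auto

lemma cd_normsq_nonneg: "cd_normsq n x \<ge> 0"
  unfolding cd_normsq_def by (rule sum_nonneg) auto

section \<open>Continuity of the Cayley-Dickson operations\<close>

lemma continuous_cd_fst:
  "(\<And>k. continuous_on S (\<lambda>x. f x k)) \<Longrightarrow> continuous_on S (\<lambda>x. cd_fst n (f x) k)"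
  by (cases "k < 2 ^ n") (auto simp: cd_fst_def)

lemma continuous_cd_snd:
  "(\<And>k. continuous_on S (\<lambda>x. f x k)) \<Longrightarrow> continuous_on S (\<lambda>x. cd_snd n (f x) k)"
  by (cases "k < 2 ^ n") (auto simp: cd_snd_def)

lemma continuous_cd_pair:
  "(\<And>k. continuous_on S (\<lambda>x. f x k)) \<Longrightarrow> (\<And>k. continuous_on S (\<lambda>x. g x k)) \<Longrightarrow>
    continuous_on S (\<lambda>x. cd_pair n (f x) (g x) k)"
  by (cases "k < 2 ^ n") (auto simp: cd_pair_def)

lemma continuous_cd_conj:
  "(\<And>k. continuous_on S (\<lambda>x. f x k)) \<Longrightarrow> continuous_on S (\<lambda>x. cd_conj n (f x) k)"
proof (induction n arbitrary: f k)
  case (Suc n)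
  show ?case
    unfolding cd_conj.simps
    by (intro continuous_cd_pair continuous_intros Suc(1) continuous_cd_fst continuous_cd_snd Suc(2))
qed auto

lemma continuous_cd_mult:
  "(\<And>k. continuous_on S (\<lambda>x. f x k)) \<Longrightarrow> (\<And>k. continuous_on S (\<lambda>x. g x k)) \<Longrightarrow>
    continuous_on S (\<lambda>x. cd_mult n (f x) (g x) k)"
proof (induction n arbitrary: f g k)
  case 0
  then show ?case by (cases "k = 0") (auto intro!: continuous_intros)
next
  case (Suc n)
  show ?case
    unfolding cd_mult.simps Let_def
    by (intro continuous_cd_pair continuous_intros Suc(1) continuous_cd_conj
          continuous_cd_fst continuous_cd_snd Suc(2,3))
qed

section \<open>Continuous Cayley-Dickson-valued functions\<close>

lemma cd_functions_simps [simp]: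
  "mult (cd_functions i) f h = (\<lambda>x. cd_mult i (f x) (h x))"
  "one (cd_functions i) = (\<lambda>x. cd_real 1)"
  "zero (cd_functions i) = (\<lambda>x k. 0)"
  "add (cd_functions i) f h = (\<lambda>x k. f x k + h x k)"
  by (simp_all add: cd_functions_def cayley_dickson_def cd_real_def)

text \<open>\<open>Euclidean_space\<close> carries the subspace topology of a product of real lines,
  so continuity can be checked coordinate by coordinate.\<close>

lemma in_carrier_cd_functions:
  "f \<in> carrier (cd_functions i) \<longleftrightarrow>
     (\<forall>k. continuous_on UNIV (\<lambda>x. f x k)) \<and> (\<forall>x k. k \<ge> 2 ^ i \<longrightarrow> f x k = 0)"
  by (auto simp: cd_functions_def Euclidean_space_def continuous_map_in_subtopology
      continuous_map_componentwise_UNIV)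

lemma abelian_monoid_cd_functions: "abelian_monoid (cd_functions i)"
  by (rule abelian_monoidI)
     (auto simp: in_carrier_cd_functions algebra_simps intro!: continuous_intros)

text \<open>Turns sums taken in the record into pointwise real sums, to which the rules for
  \<open>sum\<close> apply.\<close>

lemma finsum_cd_functions:
  assumes "finite A" "f \<in> A \<rightarrow> carrier (cd_functions i)"
  shows "finsum (cd_functions i) f A = (\<lambda>x k. \<Sum>a\<in>A. f a x k)"
proof -
  interpret abelian_monoid "cd_functions i" by (rule abelian_monoid_cd_functions)
  show ?thesis using assms
    by (induction A rule: finite_induct) (auto simp: Pi_iff)
qed


section \<open>The skew group ring\<close>

text \<open>The monomial \<open>f u\<^sub>g\<close> of the skew group ring.\<close>

definition single :: "'g \<Rightarrow> ('x \<Rightarrow> nat \<Rightarrow> real) \<Rightarrow> 'g \<Rightarrow> 'x \<Rightarrow> nat \<Rightarrow> real" where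
  "single g f = (\<lambda>k. if k = g then f else (\<lambda>x j. 0))"

locale cd_system = comm_group G for G (structure) +
  fixes s :: "'a \<Rightarrow> 'x::t2_space \<Rightarrow> 'x" and i :: nat
  assumes compact_UNIV: "compact (UNIV :: 'x set)"
    and action_hom: "s \<in> hom G homeo_group"
begin

abbreviation B :: "('x \<Rightarrow> nat \<Rightarrow> real) ring" where
  "B \<equiv> cd_functions i"

abbreviation R :: "('a \<Rightarrow> 'x \<Rightarrow> nat \<Rightarrow> real) ring" where
  "R \<equiv> skew_group_ring B G (induced_action G s)"

section \<open>The action on the space\<close>

lemma s_mult: "g \<in> carrier G \<Longrightarrow> h \<in> carrier G \<Longrightarrow> s (g \<otimes> h) x = s g (s h x)"
  using hom_mult[OF action_hom] by (simp add: homeo_group_def)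

lemma s_homeo: "g \<in> carrier G \<Longrightarrow> \<exists>h. homeomorphism UNIV UNIV (s g) h"
  using hom_in_carrier[OF action_hom] by (simp add: homeo_group_def)

lemma s_continuous: "g \<in> carrier G \<Longrightarrow> continuous_on UNIV (s g)"
  using s_homeo by (auto simp: homeomorphism_def)

text \<open>Membership in \<open>hom\<close> records only multiplicativity, so the unit law is
  derived: \<open>s \<one>\<close> is idempotent and, being a homeomorphism, injective.\<close>

lemma s_one [simp]: "s \<one> x = x"
proof -
  obtain h where "homeomorphism UNIV UNIV (s \<one>) h"
    using s_homeo by blast
  then have "h (s \<one> y) = y" for y
    by (simp add: homeomorphism_def)
  then show ?thesis
    using s_mult[of \<one> \<one> x] by (metis one_closed r_one)
qed

lemma s_inv [simp]:
  "g \<in> carrier G \<Longrightarrow> s g (s (inv g) x) = x" "g \<in> carrier G \<Longrightarrow> s (inv g) (s g x) = x"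
  using s_mult[of g "inv g" x] s_mult[of "inv g" g x] by auto

lemma translate_continuous:
  "g \<in> carrier G \<Longrightarrow> continuous_on UNIV f \<Longrightarrow> continuous_on UNIV (\<lambda>x. f (s g x))"
  by (rule continuous_on_compose2[OF _ s_continuous]) auto

lemma mult_inv_mult: "g \<in> carrier G \<Longrightarrow> k \<in> carrier G \<Longrightarrow> g \<otimes> (inv g \<otimes> k) = k"
  using m_assoc[of g "inv g" k] by simp

section \<open>Elements of the skew group ring\<close>

lemma zero_R [simp]: "zero R = (\<lambda>g x k. 0)"
  and add_R [simp]: "add R F F' = (\<lambda>g x k. F g x k + F' g x k)"
  by (auto simp: skew_group_ring_def single_def)

lemma in_carrier_R:
  "F \<in> carrier R \<longleftrightarrow>
     (\<forall>g\<in>carrier G. F g \<in> carrier B) \<and> (\<forall>g. g \<notin> carrier G \<longrightarrow> F g = (\<lambda>x k. 0)) \<and>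
     finite {g. F g \<noteq> (\<lambda>x k. 0)}"
  by (simp add: skew_group_ring_def)

lemma coeff_in_B: "F \<in> carrier R \<Longrightarrow> F g \<in> carrier B"
  by (cases "g \<in> carrier G") (auto simp: in_carrier_R in_carrier_cd_functions)

lemma translate_in_B:
  "g \<in> carrier G \<Longrightarrow> f \<in> carrier B \<Longrightarrow> (\<lambda>x. f (s g x)) \<in> carrier B"
  by (auto simp: in_carrier_cd_functions intro: translate_continuous)

lemma mult_in_B:
  "f \<in> carrier B \<Longrightarrow> h \<in> carrier B \<Longrightarrow> (\<lambda>x. cd_mult i (f x) (h x)) \<in> carrier B"
  by (auto simp: in_carrier_cd_functions cd_mult_support intro: continuous_cd_mult)

lemma sum_in_B:
  "(\<And>a. a \<in> A \<Longrightarrow> f a \<in> carrier B) \<Longrightarrow> (\<lambda>x k. \<Sum>a\<in>A. f a x k) \<in> carrier B"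
  by (simp add: in_carrier_cd_functions continuous_on_sum)

lemma real_in_B:
  assumes "continuous_on UNIV p"
  shows "(\<lambda>x. cd_real (p x)) \<in> carrier B"
proof -
  have "continuous_on UNIV (\<lambda>x. cd_real (p x) k)" for k
    using assms by (cases "k = 0") (auto simp: cd_real_def)
  then show ?thesis
    by (auto simp: in_carrier_cd_functions cd_real_def)
qed

lemma one_in_B: "(\<lambda>x. cd_real 1) \<in> carrier B"
  by (intro real_in_B continuous_on_const)

lemma single_in_R: "g \<in> carrier G \<Longrightarrow> f \<in> carrier B \<Longrightarrow> single g f \<in> carrier R"
proof -
  have "finite {k. single g f k \<noteq> (\<lambda>x k. 0)}"
    by (rule finite_subset[of _ "{g}"]) (auto simp: single_def)
  then show "g \<in> carrier G \<Longrightarrow> f \<in> carrier B \<Longrightarrow> single g f \<in> carrier R"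
    by (auto simp: in_carrier_R single_def in_carrier_cd_functions)
qed

lemma one_in_R: "single \<one> (\<lambda>x. cd_real 1) \<in> carrier R"
  by (intro single_in_R one_closed one_in_B)

lemma add_in_R: "F \<in> carrier R \<Longrightarrow> F' \<in> carrier R \<Longrightarrow> (\<lambda>g x k. F g x k + F' g x k) \<in> carrier R"
proof -
  assume F: "F \<in> carrier R" "F' \<in> carrier R"
  have "finite {g. (\<lambda>x k. F g x k + F' g x k) \<noteq> (\<lambda>x k. 0)}"
    by (rule finite_subset[of _ "{g. F g \<noteq> (\<lambda>x k. 0)} \<union> {g. F' g \<noteq> (\<lambda>x k. 0)}"])
       (use F in \<open>auto simp: in_carrier_R\<close>)
  then show ?thesis
    using F by (auto simp: in_carrier_R in_carrier_cd_functions intro!: continuous_intros)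
qed

lemma minus_in_R: "F \<in> carrier R \<Longrightarrow> (\<lambda>g x k. - F g x k) \<in> carrier R"
proof -
  assume F: "F \<in> carrier R"
  have "finite {g. (\<lambda>x k. - F g x k) \<noteq> (\<lambda>x k. 0)}"
    by (rule finite_subset[of _ "{g. F g \<noteq> (\<lambda>x k. 0)}"])
       (use F in \<open>auto simp: in_carrier_R\<close>)
  then show ?thesis
    using F by (auto simp: in_carrier_R in_carrier_cd_functions intro!: continuous_intros)
qed

lemma zero_in_R: "(\<lambda>g x k. 0) \<in> carrier R"
  by (auto simp: in_carrier_R in_carrier_cd_functions)

section \<open>Multiplication in the skew group ring\<close>

lemma mult_R_outside: "k \<notin> carrier G \<Longrightarrow> mult R F F' k = (\<lambda>x j. 0)"
proof -
  assume k: "k \<notin> carrier G"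
  interpret B: abelian_monoid B by (rule abelian_monoid_cd_functions)
  have e: "{(g, h). g \<in> carrier G \<and> h \<in> carrier G \<and> F g \<noteq> \<zero>\<^bsub>B\<^esub> \<and> F' h \<noteq> \<zero>\<^bsub>B\<^esub> \<and> g \<otimes> h = k} = {}"
    using k by auto
  show ?thesis
    unfolding skew_group_ring_def by (simp only: e ring.simps monoid.simps B.finsum_empty) simp
qed

text \<open>A pair \<open>(g, h)\<close> with \<open>g \<otimes> h = k\<close> is determined by
  \<open>g\<close>, since \<open>h = inv g \<otimes> k\<close>; the double sum thus becomes a sum
  over \<open>g\<close>. Any finite \<open>S\<close> containing the support of \<open>F\<close> is
  allowed, so that products with different left factors can be compared over one index set.\<close>

lemma mult_R:
  assumes F: "F \<in> carrier R" and F': "F' \<in> carrier R" and S: "finite S" "S \<subseteq> carrier G"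
    and supp: "\<And>g. g \<notin> S \<Longrightarrow> F g = (\<lambda>x k. 0)" and k: "k \<in> carrier G"
  shows "mult R F F' k = (\<lambda>x j. \<Sum>g\<in>S. cd_mult i (F g x) (F' (inv g \<otimes> k) (s (inv g) x)) j)"
proof -
  let ?P = "{(g, h). g \<in> carrier G \<and> h \<in> carrier G \<and> F g \<noteq> \<zero>\<^bsub>B\<^esub> \<and> F' h \<noteq> \<zero>\<^bsub>B\<^esub> \<and> g \<otimes> h = k}"
  let ?T = "{g \<in> S. F g \<noteq> \<zero>\<^bsub>B\<^esub> \<and> F' (inv g \<otimes> k) \<noteq> \<zero>\<^bsub>B\<^esub>}"
  have P: "?P = (\<lambda>g. (g, inv g \<otimes> k)) ` ?T"
  proof (intro equalityI subsetI)
    fix p assume "p \<in> ?P"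
    then obtain g h where p: "p = (g, h)" "g \<in> carrier G" "h \<in> carrier G" "F g \<noteq> \<zero>\<^bsub>B\<^esub>"
      "F' h \<noteq> \<zero>\<^bsub>B\<^esub>" "g \<otimes> h = k" by auto
    then have "h = inv g \<otimes> k" using inv_solve_left[of h g k] k by blast
    moreover have "g \<in> S" using p(4) supp by auto
    ultimately show "p \<in> (\<lambda>g. (g, inv g \<otimes> k)) ` ?T" using p by auto
  next
    fix p assume "p \<in> (\<lambda>g. (g, inv g \<otimes> k)) ` ?T"
    then obtain g where g: "p = (g, inv g \<otimes> k)" "g \<in> ?T" by auto
    then have "g \<in> carrier G" using S by auto
    then show "p \<in> ?P" using g k by (auto simp: mult_inv_mult)
  qed
  have fin: "finite ?P" unfolding P using S by auto
  have "mult R F F' k = (\<Oplus>\<^bsub>B\<^esub>p\<in>?P. F (fst p) \<otimes>\<^bsub>B\<^esub> induced_action G s (fst p) (F' (snd p)))"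
    by (simp add: skew_group_ring_def)
  also have "\<dots> = (\<lambda>x j. \<Sum>p\<in>?P. cd_mult i (F (fst p) x) (F' (snd p) (s (inv (fst p)) x)) j)"
  proof (subst finsum_cd_functions[OF fin])
    show "(\<lambda>p. F (fst p) \<otimes>\<^bsub>B\<^esub> induced_action G s (fst p) (F' (snd p))) \<in> ?P \<rightarrow> carrier B"
    proof
      fix p assume p: "p \<in> ?P"
      then have "inv (fst p) \<in> carrier G" by auto
      then show "F (fst p) \<otimes>\<^bsub>B\<^esub> induced_action G s (fst p) (F' (snd p)) \<in> carrier B"
        unfolding induced_action_def cd_functions_simps
        by (intro mult_in_B translate_in_B coeff_in_B F F')
    qed
  qed (simp add: induced_action_def)
  also have "\<dots> = (\<lambda>x j. \<Sum>g\<in>?T. cd_mult i (F g x) (F' (inv g \<otimes> k) (s (inv g) x)) j)"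
    unfolding P by (subst sum.reindex) (auto simp: inj_on_def)
  \<comment> \<open>Passing from \<open>?T\<close> to \<open>S\<close> adds only terms with a zero
    factor.\<close>
  also have "\<dots> = (\<lambda>x j. \<Sum>g\<in>S. cd_mult i (F g x) (F' (inv g \<otimes> k) (s (inv g) x)) j)"
    by (intro ext sum.mono_neutral_left) (use S in \<open>auto\<close>)
  finally show ?thesis .
qed

lemma finite_support: "F \<in> carrier R \<Longrightarrow> finite {g. F g \<noteq> (\<lambda>x k. 0)}"
  and support_subset: "F \<in> carrier R \<Longrightarrow> {g. F g \<noteq> (\<lambda>x k. 0)} \<subseteq> carrier G"
  by (auto simp: in_carrier_R)

lemma mult_R_support:
  assumes "F \<in> carrier R" "F' \<in> carrier R" "k \<in> carrier G"
  shows "mult R F F' k = (\<lambda>x j. \<Sum>g | F g \<noteq> (\<lambda>x k. 0).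
           cd_mult i (F g x) (F' (inv g \<otimes> k) (s (inv g) x)) j)"
  by (rule mult_R) (use assms finite_support support_subset in auto)

text \<open>The support of a product lies in the product set of the two supports and is therefore
  finite.\<close>

lemma mult_in_R:
  assumes F: "F \<in> carrier R" and F': "F' \<in> carrier R"
  shows "mult R F F' \<in> carrier R"
proof -
  let ?S = "{g. F g \<noteq> (\<lambda>x k. 0)}" and ?S' = "{g. F' g \<noteq> (\<lambda>x k. 0)}"
  note m = mult_R_support[OF F F']
  have 1: "mult R F F' k \<in> carrier B" if k: "k \<in> carrier G" for k
  proof -
    have "(\<lambda>x. cd_mult i (F g x) (F' (inv g \<otimes> k) (s (inv g) x))) \<in> carrier B" if "g \<in> ?S" for g
      using that support_subset[OF F] by (intro mult_in_B translate_in_B coeff_in_B F F') auto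
    then show ?thesis
      unfolding m[OF k] by (rule sum_in_B)
  qed
  have "mult R F F' k = (\<lambda>x k. 0)" if notin: "k \<notin> (\<lambda>(g, h). g \<otimes> h) ` (?S \<times> ?S')" for k
  proof (cases "k \<in> carrier G")
    case True
    have "F' (inv g \<otimes> k) = (\<lambda>x j. 0)" if g: "g \<in> ?S" for g
    proof (rule ccontr)
      assume "F' (inv g \<otimes> k) \<noteq> (\<lambda>x j. 0)"
      moreover have "g \<in> carrier G" using g support_subset[OF F] by auto
      then have "k = g \<otimes> (inv g \<otimes> k)" using True by (simp add: mult_inv_mult)
      ultimately have "k \<in> (\<lambda>(g, h). g \<otimes> h) ` (?S \<times> ?S')"
        using g by (intro image_eqI[of _ _ "(g, inv g \<otimes> k)"]) auto
      then show False using notin by contradiction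
    qed
    then show ?thesis unfolding m[OF True] by simp
  qed (rule mult_R_outside)
  then have "{k. mult R F F' k \<noteq> (\<lambda>x k. 0)} \<subseteq> (\<lambda>(g, h). g \<otimes> h) ` (?S \<times> ?S')"
    by blast
  then have "finite {k. mult R F F' k \<noteq> (\<lambda>x k. 0)}"
    by (rule finite_subset) (use finite_support F F' in auto)
  then show ?thesis
    using 1 mult_R_outside by (auto simp: in_carrier_R)
qed

lemma mult_single_left:
  assumes g: "g \<in> carrier G" and f: "f \<in> carrier B" and F: "F \<in> carrier R" and k: "k \<in> carrier G"
  shows "mult R (single g f) F k = (\<lambda>x. cd_mult i (f x) (F (inv g \<otimes> k) (s (inv g) x)))"
  by (subst mult_R[OF single_in_R[OF g f] F, of "{g}"]) (use g k in \<open>auto simp: single_def\<close>)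

lemma mult_single_right:
  assumes h: "h \<in> carrier G" and f: "f \<in> carrier B" and F: "F \<in> carrier R" and k: "k \<in> carrier G"
  shows "mult R F (single h f) k = (\<lambda>x. cd_mult i (F (k \<otimes> inv h) x) (f (s (h \<otimes> inv k) x)))"
proof -
  \<comment> \<open>Only the index \<open>k \<otimes> inv h\<close> can contribute. It is inserted
    because \<open>F\<close> may vanish there, and the sum is to be reduced to exactly this
    index.\<close>
  let ?S = "insert (k \<otimes> inv h) {g. F g \<noteq> (\<lambda>x k. 0)}"
  have S: "finite ?S" "?S \<subseteq> carrier G"
    using finite_support[OF F] support_subset[OF F] h k by auto
  have eq: "inv g \<otimes> k = h \<longleftrightarrow> g = k \<otimes> inv h" if "g \<in> carrier G" for g
    using that h k by (metis inv_closed inv_solve_left inv_solve_right m_comm)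
  have "mult R F (single h f) k =
      (\<lambda>x j. \<Sum>g\<in>?S. cd_mult i (F g x) (single h f (inv g \<otimes> k) (s (inv g) x)) j)"
    by (rule mult_R[OF F single_in_R[OF h f] S _ k]) auto
  also have "\<dots> = (\<lambda>x j. \<Sum>g\<in>{k \<otimes> inv h}. cd_mult i (F g x) (single h f (inv g \<otimes> k) (s (inv g) x)) j)"
    by (intro ext sum.mono_neutral_right) (use S eq in \<open>auto simp: single_def\<close>)
  also have "\<dots> = (\<lambda>x. cd_mult i (F (k \<otimes> inv h) x) (f (s (h \<otimes> inv k) x)))"
    using eq[of "k \<otimes> inv h"] h k by (auto simp: single_def inv_mult_group)
  finally show ?thesis .
qed

text \<open>Inverses in \<open>add_monoid R\<close> are given by a definite description. It is
  evaluated directly: the pointwise negative satisfies it, and uniqueness follows from that of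
  negatives of real numbers.\<close>

lemma additive_subgroupI_R:
  assumes I: "I \<subseteq> carrier R" and z: "(\<lambda>g x k. 0) \<in> I"
    and a: "\<And>F F'. F \<in> I \<Longrightarrow> F' \<in> I \<Longrightarrow> (\<lambda>g x k. F g x k + F' g x k) \<in> I"
    and m: "\<And>F. F \<in> I \<Longrightarrow> (\<lambda>g x k. - F g x k) \<in> I"
  shows "additive_subgroup I R"
proof
  show "I \<subseteq> carrier (add_monoid R)" using I by simp
  show "F \<otimes>\<^bsub>add_monoid R\<^esub> F' \<in> I" if "F \<in> I" "F' \<in> I" for F F'
    using a[OF that] by simp
  show "\<one>\<^bsub>add_monoid R\<^esub> \<in> I" using z by simp
  show "inv\<^bsub>add_monoid R\<^esub> F \<in> I" if "F \<in> I" for F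
  proof -
    have "inv\<^bsub>add_monoid R\<^esub> F = (\<lambda>g x k. - F g x k)"
      unfolding m_inv_def
    proof (rule the_equality)
      show "(\<lambda>g x k. - F g x k) \<in> carrier (add_monoid R) \<and>
          F \<otimes>\<^bsub>add_monoid R\<^esub> (\<lambda>g x k. - F g x k) = \<one>\<^bsub>add_monoid R\<^esub> \<and>
          (\<lambda>g x k. - F g x k) \<otimes>\<^bsub>add_monoid R\<^esub> F = \<one>\<^bsub>add_monoid R\<^esub>"
        using m[OF that] I by auto
    next
      fix F' assume "F' \<in> carrier (add_monoid R) \<and> F \<otimes>\<^bsub>add_monoid R\<^esub> F' = \<one>\<^bsub>add_monoid R\<^esub> \<and>
          F' \<otimes>\<^bsub>add_monoid R\<^esub> F = \<one>\<^bsub>add_monoid R\<^esub>"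
      then have "F g x k + F' g x k = 0" for g x k
        by (simp add: fun_eq_iff)
      then show "F' = (\<lambda>g x k. - F g x k)"
        by (auto simp: fun_eq_iff eq_neg_iff_add_eq_0 add.commute)
    qed
    then show ?thesis using m[OF that] by simp
  qed
qed

text \<open>A compact Hausdorff space is normal, so Urysohn's lemma separates \<open>Y\<close> from
  the closed set \<open>{z}\<close>.\<close>

lemma urysohn:
  assumes "closed Y" "z \<notin> Y"
  shows "\<exists>p::'x \<Rightarrow> real. continuous_on UNIV p \<and> p z = 1 \<and> (\<forall>x\<in>Y. p x = 0)"
proof -
  have "Hausdorff_space (euclidean :: 'x topology)"
    unfolding Hausdorff_space_def disjnt_def by (simp, metis hausdorff)
  moreover have "compact_space (euclidean :: 'x topology)"
    using compact_UNIV by (simp add: compact_space_def)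
  ultimately have "normal_space (euclidean :: 'x topology)"
    using compact_Hausdorff_or_regular_imp_normal_space by blast
  moreover have "closedin euclidean Y" "closedin euclidean {z}" "disjnt Y {z}"
    using assms by (auto simp: disjnt_def)
  ultimately obtain p where "continuous_map euclidean euclideanreal p" "p ` Y \<subseteq> {0}" "p ` {z} \<subseteq> {1}"
    by (rule Urysohn_lemma_alt)
  then show ?thesis
    by (intro exI[of _ p]) auto
qed

section \<open>Simplicity implies minimality\<close>

text \<open>The ideal of elements vanishing on \<open>Y\<close> is nonzero, by a Urysohn function at
  a point outside \<open>Y\<close>, and proper, because the constant function \<open>1\<close> does
  not vanish at a point of \<open>Y\<close>.\<close>

lemma simple_imp_minimal:
  assumes simple: "simple_nonassoc_ring R"
  shows "minimal_system G s"
proof (rule ccontr)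
  assume "\<not> minimal_system G s"
  then obtain Y y z where Y: "closed Y" "invariant_subset G s Y" and y: "y \<in> Y" and z: "z \<notin> Y"
    unfolding minimal_system_def by auto
  have inv: "s g x \<in> Y" if "g \<in> carrier G" "x \<in> Y" for g x
    using Y(2) that by (auto simp: invariant_subset_def)
  let ?I = "{F \<in> carrier R. \<forall>g. \<forall>x\<in>Y. F g x = (\<lambda>k. 0)}"
  have "two_sided_ideal ?I R"
    unfolding two_sided_ideal_def
  proof (intro conjI ballI)
    show "additive_subgroup ?I R"
      by (rule additive_subgroupI_R) (auto simp: add_in_R minus_in_R zero_in_R)
  next
    fix F X assume F: "F \<in> ?I" and X: "X \<in> carrier R"
    then have F1: "F \<in> carrier R" by simp
    have "mult R X F k x = (\<lambda>j. 0)" if x: "x \<in> Y" for k x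
    proof (cases "k \<in> carrier G")
      case True
      \<comment> \<open>Left multiplication evaluates the coefficients of \<open>F\<close> at
        translates of \<open>x\<close>, which stay in \<open>Y\<close> by invariance.\<close>
      have "F (inv g \<otimes> k) (s (inv g) x) = (\<lambda>j. 0)" if "X g \<noteq> (\<lambda>x k. 0)" for g
        using F inv[of "inv g" x] x support_subset[OF X] that by auto
      then show ?thesis
        unfolding mult_R_support[OF X F1 True] by simp
    qed (simp add: mult_R_outside)
    then show "mult R X F \<in> ?I" using mult_in_R[OF X F1] by simp
    have "mult R F X k x = (\<lambda>j. 0)" if x: "x \<in> Y" for k x
    proof (cases "k \<in> carrier G")
      case True
      have "F g x = (\<lambda>j. 0)" for g
        using F x by auto
      then show ?thesis
        unfolding mult_R_support[OF F1 X True] by simp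
    qed (simp add: mult_R_outside)
    then show "mult R F X \<in> ?I" using mult_in_R[OF F1 X] by simp
  qed
  then consider "?I = {zero R}" | "?I = carrier R"
    using simple by (auto simp: simple_nonassoc_ring_def)
  then show False
  proof cases
    case 1
    obtain p :: "'x \<Rightarrow> real" where p: "continuous_on UNIV p" "p z = 1" "\<forall>x\<in>Y. p x = 0"
      using urysohn[OF Y(1) z] by blast
    have "single \<one> (\<lambda>x. cd_real (p x)) \<in> ?I"
      using single_in_R[OF one_closed real_in_B[OF p(1)]] p by (simp add: single_def)
    then have "single \<one> (\<lambda>x. cd_real (p x)) = (\<lambda>g x k. 0)"
      using 1 by simp
    then have "single \<one> (\<lambda>x. cd_real (p x)) \<one> z 0 = 0"
      by metis
    then show False using p(2) by (simp add: single_def cd_real_def)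
  next
    case 2
    have "single \<one> (\<lambda>x. cd_real 1) \<in> ?I"
      using 2 one_in_R by blast
    then have "single \<one> (\<lambda>x. cd_real 1) \<one> y = (\<lambda>k. 0)"
      using y by blast
    then have "single \<one> (\<lambda>x. cd_real 1) \<one> y 0 = 0"
      by metis
    then show False by (simp add: single_def cd_real_def)
  qed
qed

section \<open>Simplicity implies faithfulness\<close>

lemma diff_in_R: "F \<in> carrier R \<Longrightarrow> F' \<in> carrier R \<Longrightarrow> (\<lambda>g x k. F g x k - F' g x k) \<in> carrier R"
  using add_in_R[of F "\<lambda>g x k. - F' g x k"] minus_in_R[of F'] by simp

lemma mult_diff_right:
  assumes "X \<in> carrier R" "F \<in> carrier R" "F' \<in> carrier R"
  shows "mult R X (\<lambda>g x k. F g x k - F' g x k) = (\<lambda>g x k. mult R X F g x k - mult R X F' g x k)"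
proof
  fix k
  show "mult R X (\<lambda>g x k. F g x k - F' g x k) k = (\<lambda>x j. mult R X F k x j - mult R X F' k x j)"
  proof (cases "k \<in> carrier G")
    case True
    show ?thesis
      unfolding mult_R_support[OF assms(1) diff_in_R[OF assms(2,3)] True]
        mult_R_support[OF assms(1,2) True] mult_R_support[OF assms(1,3) True]
      by (simp add: cd_mult_diff sum_subtractf)
  qed (simp add: mult_R_outside)
qed

lemma mult_diff_left:
  assumes "X \<in> carrier R" "F \<in> carrier R" "F' \<in> carrier R"
  shows "mult R (\<lambda>g x k. F g x k - F' g x k) X = (\<lambda>g x k. mult R F X g x k - mult R F' X g x k)"
proof
  fix k
  let ?S = "{g. F g \<noteq> (\<lambda>x k. 0)} \<union> {g. F' g \<noteq> (\<lambda>x k. 0)}"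
  have S: "finite ?S" "?S \<subseteq> carrier G"
    using assms finite_support support_subset by auto
  show "mult R (\<lambda>g x k. F g x k - F' g x k) X k = (\<lambda>x j. mult R F X k x j - mult R F' X k x j)"
  proof (cases "k \<in> carrier G")
    case True
    have "mult R (\<lambda>g x k. F g x k - F' g x k) X k =
        (\<lambda>x j. \<Sum>g\<in>?S. cd_mult i (\<lambda>k. F g x k - F' g x k) (X (inv g \<otimes> k) (s (inv g) x)) j)"
      by (rule mult_R[OF diff_in_R[OF assms(2,3)] assms(1) S _ True]) auto
    moreover have "mult R F X k = (\<lambda>x j. \<Sum>g\<in>?S. cd_mult i (F g x) (X (inv g \<otimes> k) (s (inv g) x)) j)"
      by (rule mult_R[OF assms(2,1) S _ True]) auto
    moreover have "mult R F' X k = (\<lambda>x j. \<Sum>g\<in>?S. cd_mult i (F' g x) (X (inv g \<otimes> k) (s (inv g) x)) j)"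
      by (rule mult_R[OF assms(3,1) S _ True]) auto
    ultimately show ?thesis
      by (simp add: cd_mult_diff sum_subtractf)
  qed (simp add: mult_R_outside)
qed

text \<open>For \<open>g\<close> acting trivially this is \<open>u\<^sub>g F\<close>, which is also
  \<open>F u\<^sub>g\<close> because \<open>G\<close> is abelian.\<close>

definition shift :: "'a \<Rightarrow> ('a \<Rightarrow> 'x \<Rightarrow> nat \<Rightarrow> real) \<Rightarrow> 'a \<Rightarrow> 'x \<Rightarrow> nat \<Rightarrow> real" where
  "shift g F = (\<lambda>k. if k \<in> carrier G then F (inv g \<otimes> k) else (\<lambda>x j. 0))"

lemma cd_mult_one:
  assumes "\<And>k. k \<ge> 2 ^ n \<Longrightarrow> x k = 0"
  shows "cd_mult n (cd_real 1) x = x" "cd_mult n x (cd_real 1) = x"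
  using assms by (auto simp: cd_mult_real fun_eq_iff not_less)

lemma in_B_support: "f \<in> carrier B \<Longrightarrow> k \<ge> 2 ^ i \<Longrightarrow> f x k = 0"
  by (auto simp: in_carrier_cd_functions)

text \<open>Left multiplication by \<open>u\<^sub>g\<close> moves coefficients by \<open>g\<close>
  and translates them by \<open>s (inv g)\<close>, here the identity. Membership of the shift in
  \<open>R\<close> then follows from closure under products.\<close>

lemma shift_eq_mult:
  assumes g: "g \<in> carrier G" and triv: "\<And>x. s g x = x" and F: "F \<in> carrier R"
  shows "shift g F = mult R (single g (\<lambda>x. cd_real 1)) F"
proof
  fix k
  have "s (inv g) x = x" for x
    using s_inv(2)[OF g, of x] triv by simp
  moreover have "cd_mult i (cd_real 1) (F (inv g \<otimes> k) x) = F (inv g \<otimes> k) x" for x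
    by (intro cd_mult_one in_B_support[OF coeff_in_B[OF F]])
  ultimately show "shift g F k = mult R (single g (\<lambda>x. cd_real 1)) F k"
    using mult_single_left[OF g one_in_B F, of k]
    by (cases "k \<in> carrier G") (auto simp: shift_def mult_R_outside)
qed

lemma shift_in_R:
  assumes "g \<in> carrier G" "\<And>x. s g x = x" "F \<in> carrier R"
  shows "shift g F \<in> carrier R"
  unfolding shift_eq_mult[OF assms] by (intro mult_in_R single_in_R one_in_B assms)

text \<open>The two arguments \<open>inv h \<otimes> (inv g \<otimes> k)\<close> and
  \<open>inv g \<otimes> (inv h \<otimes> k)\<close> agree in an abelian group. In ring terms this
  is \<open>X (F u\<^sub>g) = (X F) u\<^sub>g\<close>, one half of what makes the elements
  \<open>F - F u\<^sub>g\<close> an ideal.\<close>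

lemma mult_shift_right:
  assumes g: "g \<in> carrier G" and triv: "\<And>x. s g x = x"
    and F: "F \<in> carrier R" and X: "X \<in> carrier R"
  shows "mult R X (shift g F) = shift g (mult R X F)"
proof
  fix k
  show "mult R X (shift g F) k = shift g (mult R X F) k"
  proof (cases "k \<in> carrier G")
    case True
    then have k': "inv g \<otimes> k \<in> carrier G" using g by simp
    have "shift g F (inv h \<otimes> k) = F (inv h \<otimes> (inv g \<otimes> k))" if "X h \<noteq> (\<lambda>x k. 0)" for h
    proof -
      have "h \<in> carrier G" using that support_subset[OF X] by auto
      then show ?thesis using True g by (simp add: shift_def m_lcomm)
    qed
    then show ?thesis
      unfolding mult_R_support[OF X shift_in_R[OF g triv F] True]
      using True by (simp add: shift_def mult_R_support[OF X F k'])
  qed (simp add: mult_R_outside shift_def)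
qed

lemma shift_support:
  assumes g: "g \<in> carrier G" and F: "F \<in> carrier R"
    and h: "h \<notin> (\<otimes>) g ` {h. F h \<noteq> (\<lambda>x k. 0)}"
  shows "shift g F h = (\<lambda>x k. 0)"
proof (cases "h \<in> carrier G")
  case True
  then have "h = g \<otimes> (inv g \<otimes> h)" using g by (simp add: mult_inv_mult)
  then have "F (inv g \<otimes> h) = (\<lambda>x k. 0)" using h by blast
  then show ?thesis by (simp add: shift_def)
qed (simp add: shift_def)

lemma shift_mult: "g \<in> carrier G \<Longrightarrow> h \<in> carrier G \<Longrightarrow> shift g F (g \<otimes> h) = F h"
  using m_assoc[of "inv g" g h] by (simp add: shift_def)

lemma inj_on_mult: "g \<in> carrier G \<Longrightarrow> F \<in> carrier R \<Longrightarrow> inj_on ((\<otimes>) g) {h. F h \<noteq> (\<lambda>x k. 0)}"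
  using support_subset[of F] by (auto simp: inj_on_def subset_iff)

text \<open>The substitution of \<open>g \<otimes> h\<close> for the summation index
  \<open>h\<close> turns one side into the other: \<open>g\<close> acts trivially, so
  \<open>g \<otimes> h\<close> and \<open>h\<close> act alike and the translated points do not
  change.\<close>

lemma mult_shift_left:
  assumes g: "g \<in> carrier G" and triv: "\<And>x. s g x = x"
    and F: "F \<in> carrier R" and X: "X \<in> carrier R"
  shows "mult R (shift g F) X = shift g (mult R F X)"
proof
  fix k
  let ?S = "{h. F h \<noteq> (\<lambda>x k. 0)}"
  show "mult R (shift g F) X k = shift g (mult R F X) k"
  proof (cases "k \<in> carrier G")
    case True
    then have k': "inv g \<otimes> k \<in> carrier G" using g by simp
    have triv': "s (inv g) x = x" for x
      using s_inv(2)[OF g, of x] triv by simp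
    have S: "finite ((\<otimes>) g ` ?S)" "(\<otimes>) g ` ?S \<subseteq> carrier G"
      using finite_support[OF F] support_subset[OF F] g by auto
    have "mult R (shift g F) X k = (\<lambda>x j. \<Sum>h\<in>(\<otimes>) g ` ?S.
        cd_mult i (shift g F h x) (X (inv h \<otimes> k) (s (inv h) x)) j)"
      by (rule mult_R[OF shift_in_R[OF g triv F] X S _ True]) (rule shift_support[OF g F])
    also have "\<dots> = (\<lambda>x j. \<Sum>h\<in>?S.
        cd_mult i (F h x) (X (inv h \<otimes> (inv g \<otimes> k)) (s (inv h) x)) j)"
    proof (intro ext, subst sum.reindex[OF inj_on_mult[OF g F]], intro sum.cong refl)
      fix x j h assume "h \<in> ?S"
      then have h: "h \<in> carrier G" using support_subset[OF F] by auto
      have "inv (g \<otimes> h) \<otimes> k = inv h \<otimes> (inv g \<otimes> k)"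
        using g h True by (simp add: inv_mult_group m_assoc)
      moreover have "s (inv (g \<otimes> h)) x = s (inv h) x"
        using g h s_mult[of "inv h" "inv g" x] triv' by (simp add: inv_mult_group)
      ultimately show "((\<lambda>h. cd_mult i (shift g F h x) (X (inv h \<otimes> k) (s (inv h) x)) j) \<circ> (\<otimes>) g) h =
          cd_mult i (F h x) (X (inv h \<otimes> (inv g \<otimes> k)) (s (inv h) x)) j"
        using g h by (simp add: shift_mult)
    qed
    also have "\<dots> = shift g (mult R F X) k"
      using True by (simp add: shift_def mult_R_support[OF F X k'])
    finally show ?thesis .
  qed (simp add: mult_R_outside shift_def)
qed

text \<open>The ideal of all \<open>F - F u\<^sub>g\<close> is proper since the coefficients of each element sum to \<open>0\<close>.\<close>

lemma simple_imp_faithful: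
  assumes simple: "simple_nonassoc_ring R"
  shows "faithful_system G s"
proof (rule ccontr)
  assume "\<not> faithful_system G s"
  then obtain g where g: "g \<in> carrier G" and g1: "g \<noteq> \<one>" and triv: "\<And>x. s g x = x"
    by (auto simp: faithful_system_def)
  let ?D = "\<lambda>F h x k. F h x k - shift g F h x k"
  let ?I = "?D ` carrier R"
  note sh = shift_in_R[OF g triv]
  have "two_sided_ideal ?I R"
    unfolding two_sided_ideal_def
  proof (intro conjI ballI)
    show "additive_subgroup ?I R"
    proof (rule additive_subgroupI_R)
      show "?I \<subseteq> carrier R" using diff_in_R sh by blast
      show "(\<lambda>g x k. 0) \<in> ?I"
        by (rule image_eqI[OF _ zero_in_R]) (simp add: shift_def)
    next
      fix F F' assume "F \<in> ?I" "F' \<in> ?I"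
      then obtain A A' where A: "F = ?D A" "F' = ?D A'" "A \<in> carrier R" "A' \<in> carrier R"
        by blast
      show "(\<lambda>g x k. F g x k + F' g x k) \<in> ?I"
        by (rule image_eqI[OF _ add_in_R[OF A(3,4)]]) (auto simp: A shift_def fun_eq_iff)
    next
      fix F assume "F \<in> ?I"
      then obtain A where A: "F = ?D A" "A \<in> carrier R"
        by blast
      show "(\<lambda>g x k. - F g x k) \<in> ?I"
        by (rule image_eqI[OF _ minus_in_R[OF A(2)]]) (auto simp: A shift_def fun_eq_iff)
    qed
  next
    fix F X assume "F \<in> ?I" and X: "X \<in> carrier R"
    then obtain A where A: "F = ?D A" "A \<in> carrier R"
      by blast
    show "mult R X F \<in> ?I"
      unfolding A(1) mult_diff_right[OF X A(2) sh[OF A(2)]] mult_shift_right[OF g triv A(2) X]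
      using mult_in_R[OF X A(2)] by blast
    show "mult R F X \<in> ?I"
      unfolding A(1) mult_diff_left[OF X A(2) sh[OF A(2)]] mult_shift_left[OF g triv A(2) X]
      using mult_in_R[OF A(2) X] by blast
  qed
  then consider "?I = {zero R}" | "?I = carrier R"
    using simple by (auto simp: simple_nonassoc_ring_def)
  then show False
  proof cases
    case 1
    \<comment> \<open>The element \<open>u\<^sub>1 - u\<^sub>g\<close> has coefficient
      \<open>1\<close> at \<open>\<one>\<close>, since \<open>g\<close> is not the identity, so the
      ideal is nonzero.\<close>
    have "?D (single \<one> (\<lambda>x. cd_real 1)) = (\<lambda>g x k. 0)"
      using 1 one_in_R by auto
    then have "?D (single \<one> (\<lambda>x. cd_real 1)) \<one> undefined 0 = 0"
      by metis
    moreover have "inv g \<noteq> \<one>"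
      using g g1 by (metis inv_inv inv_one)
    ultimately show False
      using g by (simp add: shift_def single_def cd_real_def)
  next
    case 2
    have "single \<one> (\<lambda>x. cd_real 1) \<in> ?I"
      using 2 one_in_R by blast
    then obtain F where F: "F \<in> carrier R" and eq: "single \<one> (\<lambda>x. cd_real 1) = ?D F"
      by blast
    let ?S = "{h. F h \<noteq> (\<lambda>x k. 0)}"
    \<comment> \<open>A finite set containing \<open>\<one>\<close> and the supports of
      \<open>F\<close> and of its shift. Over it the coefficients are summed at an arbitrary point
      and coordinate \<open>0\<close>: shifting only permutes them, so the difference has sum
      \<open>0\<close>, whereas the unit has sum \<open>1\<close>.\<close>
    let ?T = "insert \<one> (?S \<union> (\<otimes>) g ` ?S)"
    let ?x = "undefined :: 'x"
    have T: "finite ?T" using finite_support[OF F] by simp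
    have "(\<Sum>h\<in>?T. shift g F h ?x 0) = (\<Sum>h\<in>(\<otimes>) g ` ?S. shift g F h ?x 0)"
      by (rule sum.mono_neutral_right[OF T]) (use shift_support[OF g F] in auto)
    also have "\<dots> = (\<Sum>h\<in>?S. F h ?x 0)"
    proof (subst sum.reindex[OF inj_on_mult[OF g F]], intro sum.cong refl)
      fix h assume "h \<in> ?S"
      then show "((\<lambda>h. shift g F h ?x 0) \<circ> (\<otimes>) g) h = F h ?x 0"
        using support_subset[OF F] g by (auto simp: shift_mult)
    qed
    also have "\<dots> = (\<Sum>h\<in>?T. F h ?x 0)"
      by (rule sum.mono_neutral_left[OF T]) auto
    finally have "(\<Sum>h\<in>?T. ?D F h ?x 0) = 0"
      by (simp add: sum_subtractf)
    moreover have "?D F h ?x 0 = (if h = \<one> then 1 else 0)" for h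
    proof -
      have "?D F h ?x 0 = single \<one> (\<lambda>x. cd_real 1) h ?x 0"
        unfolding eq ..
      then show ?thesis by (simp add: single_def cd_real_def)
    qed
    ultimately have "(\<Sum>h\<in>?T. if h = \<one> then 1 else 0 :: real) = 0"
      by simp
    then show False using T by simp
  qed
qed

section \<open>Minimality and faithfulness imply simplicity\<close>

lemma minimal_faithful_imp_free:
  assumes min: "minimal_system G s" and faith: "faithful_system G s"
    and g: "g \<in> carrier G" "g \<noteq> \<one>"
  shows "s g x \<noteq> x"
proof
  assume x: "s g x = x"
  have "closed {x. s g x = x}"
    by (rule closed_Collect_eq[OF s_continuous[OF g(1)] continuous_on_id])
  moreover have "invariant_subset G s {x. s g x = x}"
    unfolding invariant_subset_def
  proof (intro ballI image_subsetI CollectI)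
    fix h y assume h: "h \<in> carrier G" and "y \<in> {x. s g x = x}"
    then have "s h (s g y) = s h y" by simp
    \<comment> \<open>By commutativity \<open>s h\<close> commutes with \<open>s g\<close> and so
      maps fixed points of \<open>s g\<close> to fixed points.\<close>
    then show "s g (s h y) = s h y"
      using s_mult[OF g(1) h, of y] s_mult[OF h g(1), of y] m_comm[OF h g(1)] by simp
  qed
  ultimately have "{x. s g x = x} = UNIV"
    using min x unfolding minimal_system_def by blast
  then show False
    using faith g by (auto simp: faithful_system_def)
qed

text \<open>For each \<open>g\<close> in \<open>S\<close> disjoint open sets \<open>U g\<close> and
  \<open>V g\<close> separate \<open>z\<close> from its translate. On the finite intersection
  \<open>W\<close>, a point lies in every \<open>U g\<close> while its translate by
  \<open>inv g\<close> lies in \<open>V g\<close>, hence outside \<open>W\<close>. A Urysohn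
  function vanishing off \<open>W\<close> therefore has the required products.\<close>

lemma ex_bump_function:
  assumes free: "\<And>g x. g \<in> S \<Longrightarrow> s (inv g) x \<noteq> x" and S: "finite S" "S \<subseteq> carrier G"
  shows "\<exists>p::'x \<Rightarrow> real. continuous_on UNIV p \<and> p z = 1 \<and> (\<forall>g\<in>S. \<forall>x. p x * p (s (inv g) x) = 0)"
proof -
  have "\<exists>U V. open U \<and> open V \<and> z \<in> U \<and> s (inv g) z \<in> V \<and> U \<inter> V = {}" if "g \<in> S" for g
    using free[OF that] hausdorff by metis
  then obtain U V where UV: "\<And>g. g \<in> S \<Longrightarrow>
      open (U g) \<and> open (V g) \<and> z \<in> U g \<and> s (inv g) z \<in> V g \<and> U g \<inter> V g = {}"
    by metis
  define W where "W = (\<Inter>g\<in>S. U g \<inter> s (inv g) -` V g)"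
  have "open W"
    unfolding W_def using S UV
    by (intro open_INT ballI open_Int open_vimage s_continuous) auto
  then have "closed (-W)" by (simp add: closed_def)
  moreover have "z \<notin> -W" using UV by (simp add: W_def)
  ultimately obtain p :: "'x \<Rightarrow> real" where p: "continuous_on UNIV p" "p z = 1" "\<forall>x\<in>-W. p x = 0"
    using urysohn by blast
  have "p x * p (s (inv g) x) = 0" if g: "g \<in> S" for g x
  proof (rule ccontr)
    assume "p x * p (s (inv g) x) \<noteq> 0"
    then have "x \<in> W" "s (inv g) x \<in> W"
      using p(3) by auto
    then have "s (inv g) x \<in> V g \<inter> U g"
      using g by (auto simp: W_def)
    then show False using UV[OF g] by blast
  qed
  then show ?thesis using p by blast
qed

lemma mult_single_single:
  assumes f: "f \<in> carrier B" and h: "h \<in> carrier B"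
  shows "mult R (single \<one> f) (single \<one> h) = single \<one> (\<lambda>x. cd_mult i (f x) (h x))"
proof
  fix k
  show "mult R (single \<one> f) (single \<one> h) k = single \<one> (\<lambda>x. cd_mult i (f x) (h x)) k"
    using mult_single_left[OF one_closed f single_in_R[OF one_closed h], of k]
    by (cases "k \<in> carrier G") (auto simp: single_def mult_R_outside)
qed

lemma mult_one_right:
  assumes F: "F \<in> carrier R"
  shows "mult R F (single \<one> (\<lambda>x. cd_real 1)) = F"
proof
  fix k
  have "cd_mult i (F k x) (cd_real 1) = F k x" for x
    by (intro cd_mult_one in_B_support[OF coeff_in_B[OF F]])
  then show "mult R F (single \<one> (\<lambda>x. cd_real 1)) k = F k"
    using mult_single_right[OF one_closed one_in_B F, of k] F
    by (cases "k \<in> carrier G") (auto simp: mult_R_outside in_carrier_R)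
qed

text \<open>Conjugation by \<open>u\<^sub>g\<close> realises the induced action inside the ring: the
  left factor translates \<open>f\<close> and moves it to index \<open>g\<close>, the right factor
  moves it back to \<open>\<one>\<close>. An ideal thus contains the translates of its monomials at
  \<open>\<one>\<close>.\<close>

lemma conjugate_single:
  assumes g: "g \<in> carrier G" and f: "f \<in> carrier B"
  shows "mult R (mult R (single g (\<lambda>x. cd_real 1)) (single \<one> f)) (single (inv g) (\<lambda>x. cd_real 1)) =
    single \<one> (\<lambda>x. f (s (inv g) x))" (is "mult R ?M ?N = _")
proof
  fix k
  have f1: "single \<one> f \<in> carrier R" using f by (intro single_in_R) auto
  have M: "?M \<in> carrier R" by (rule mult_in_R[OF single_in_R[OF g one_in_B] f1])
  show "mult R ?M ?N k = single \<one> (\<lambda>x. f (s (inv g) x)) k"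
  proof (cases "k \<in> carrier G")
    case True
    have kg: "k \<otimes> g \<in> carrier G" using True g by simp
    have "mult R ?M ?N k = ?M (k \<otimes> g)"
      using mult_single_right[OF inv_closed[OF g] one_in_B M True] g
        cd_mult_one(2)[OF in_B_support[OF coeff_in_B[OF M]]] by simp
    also have "\<dots> = (\<lambda>x. single \<one> f (inv g \<otimes> (k \<otimes> g)) (s (inv g) x))"
      using mult_single_left[OF g one_in_B f1 kg]
        cd_mult_one(1)[OF in_B_support[OF coeff_in_B[OF f1]]] by simp
    also have "inv g \<otimes> (k \<otimes> g) = k"
      using True g by (simp add: m_lcomm)
    finally show ?thesis
      by (auto simp: single_def)
  qed (auto simp: mult_R_outside single_def)
qed

text \<open>In \<open>p (F p)\<close> the coefficient at \<open>k\<close> is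
  \<open>p x * p (s (inv k) x) * F k x\<close>. For \<open>k\<close> in the support of
  \<open>F\<close> other than \<open>\<one>\<close> the first two factors multiply to zero; at
  \<open>\<one>\<close> they give the square of \<open>p x\<close>.\<close>

lemma ideal_compress:
  assumes I: "two_sided_ideal I R" and F: "F \<in> I"
    and p: "continuous_on UNIV p"
    and disj: "\<And>g x. F g \<noteq> (\<lambda>x k. 0) \<Longrightarrow> g \<noteq> \<one> \<Longrightarrow> p x * p (s (inv g) x) = 0"
  shows "single \<one> (\<lambda>x j. p x * p x * F \<one> x j) \<in> I"
proof -
  have IR: "I \<subseteq> carrier R" and ideal: "\<And>F X. F \<in> I \<Longrightarrow> X \<in> carrier R \<Longrightarrow> mult R X F \<in> I \<and> mult R F X \<in> I"
    using I by (auto simp: two_sided_ideal_def additive_subgroup.a_subset)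
  let ?P = "\<lambda>x. cd_real (p x)"
  let ?N = "mult R F (single \<one> ?P)"
  have P: "?P \<in> carrier B" using p by (rule real_in_B)
  have PR: "single \<one> ?P \<in> carrier R" using P by (intro single_in_R) auto
  have FR: "F \<in> carrier R" using F IR by blast
  have N: "?N \<in> carrier R" "?N \<in> I" using ideal[OF F PR] IR by auto
  have supp: "j \<ge> 2 ^ i \<Longrightarrow> F k x j = 0" for k x j
    using in_B_support[OF coeff_in_B[OF FR]] by blast
  have "mult R (single \<one> ?P) ?N = single \<one> (\<lambda>x j. p x * p x * F \<one> x j)"
  proof
    fix k
    show "mult R (single \<one> ?P) ?N k = single \<one> (\<lambda>x j. p x * p x * F \<one> x j) k"
    proof (cases "k \<in> carrier G")
      case True
      have "mult R (single \<one> ?P) ?N k = (\<lambda>x j. p x * p (s (inv k) x) * F k x j)"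
        using mult_single_left[OF one_closed P N(1) True] mult_single_right[OF one_closed P FR True] True
        by (auto simp: cd_mult_real fun_eq_iff supp not_less)
      also have "\<dots> = single \<one> (\<lambda>x j. p x * p x * F \<one> x j) k"
      proof (cases "k = \<one>")
        case False
        have "p x * p (s (inv k) x) * F k x j = 0" for x j
          using disj[of k x] False by (cases "F k = (\<lambda>x k. 0)") auto
        then show ?thesis using False by (simp only: single_def if_False)
      qed (simp add: single_def)
      finally show ?thesis .
    qed (auto simp: mult_R_outside single_def)
  qed
  then show ?thesis
    using ideal[OF N(2) PR] by simp
qed

lemma ideal_with_single_eq_carrier:
  assumes min: "minimal_system G s" and I: "two_sided_ideal I R"
    and f: "f \<in> carrier B" "single \<one> f \<in> I" "f z \<noteq> (\<lambda>k. 0)"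
  shows "I = carrier R"
proof -
  interpret additive_subgroup I R
    using I by (simp add: two_sided_ideal_def)
  have ideal: "mult R X F \<in> I" "mult R F X \<in> I" if "F \<in> I" "X \<in> carrier R" for F X
    using I that by (auto simp: two_sided_ideal_def)
  define N where "N = (\<lambda>x. cd_normsq i (f x))"
  have fc: "continuous_on UNIV (\<lambda>x. f x k)" for k
    using f(1) by (auto simp: in_carrier_cd_functions)
  have N: "continuous_on UNIV N"
    unfolding N_def cd_normsq_def by (intro continuous_intros fc)
  have Npos: "N z > 0"
  proof -
    obtain k where k: "f z k \<noteq> 0" using f(3) by auto
    then have "k < 2 ^ i" using in_B_support[OF f(1), of k z] by (meson not_less)
    then show ?thesis unfolding N_def using k by (rule cd_normsq_pos)
  qed
  have fconj: "(\<lambda>x. cd_conj i (f x)) \<in> carrier B"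
    using f(1) cd_conj_support by (auto simp: in_carrier_cd_functions intro: continuous_cd_conj)
  \<comment> \<open>Multiplying \<open>f u\<^sub>1\<close> on the right by the monomial of the
    conjugate function makes the coefficient real.\<close>
  have NI: "single \<one> (\<lambda>x. cd_real (N x)) \<in> I"
    using ideal(2)[OF f(2) single_in_R[OF one_closed fconj]]
      cd_mult_conj(1)[OF in_B_support[OF f(1)]]
    by (simp add: mult_single_single[OF f(1) fconj] N_def)
  have NgI: "single \<one> (\<lambda>x. cd_real (N (s (inv g) x))) \<in> I" if g: "g \<in> carrier G" for g
    using ideal(2)[OF ideal(1)[OF NI single_in_R[OF g one_in_B]] single_in_R[OF inv_closed[OF g] one_in_B]]
      conjugate_single[OF g real_in_B[OF N]] by simp

  have cont: "continuous_on UNIV (\<lambda>x. N (s g x))" if "g \<in> carrier G" for g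
    by (rule translate_continuous[OF that N])
  have "closed {x. N (s g x) = 0}" if "g \<in> carrier G" for g
    by (rule closed_Collect_eq[OF cont[OF that] continuous_on_const])
  then have "closed (\<Inter>g\<in>carrier G. {x. N (s g x) = 0})"
    by (intro closed_INT) auto
  moreover have "(\<Inter>g\<in>carrier G. {x. N (s g x) = 0}) = {x. \<forall>g\<in>carrier G. N (s g x) = 0}"
    by auto
  ultimately have cl: "closed {x. \<forall>g\<in>carrier G. N (s g x) = 0}"
    by simp
  \<comment> \<open>The common zeros of all translates of \<open>N\<close> form a closed invariant
    set that misses \<open>z\<close>; minimality forces it to be empty.\<close>
  have "invariant_subset G s {x. \<forall>g\<in>carrier G. N (s g x) = 0}"
    unfolding invariant_subset_def
  proof (intro ballI image_subsetI CollectI)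
    fix g h x assume g: "g \<in> carrier G" and x: "x \<in> {x. \<forall>g\<in>carrier G. N (s g x) = 0}"
      and h: "h \<in> carrier G"
    have "N (s (h \<otimes> g) x) = 0"
      using x m_closed[OF h g] by blast
    then show "N (s h (s g x)) = 0"
      by (simp only: s_mult[OF h g])
  qed
  moreover have "z \<notin> {x. \<forall>g\<in>carrier G. N (s g x) = 0}"
  proof -
    have "N (s \<one> z) \<noteq> 0" using Npos by simp
    then show ?thesis by blast
  qed
  ultimately have "{x. \<forall>g\<in>carrier G. N (s g x) = 0} = {}"
    using min cl unfolding minimal_system_def by blast
  then have ex: "\<exists>g\<in>carrier G. N (s (inv g) x) \<noteq> 0" for x
  proof -
    obtain g where "g \<in> carrier G" "N (s g x) \<noteq> 0"
      using \<open>{x. \<forall>g\<in>carrier G. N (s g x) = 0} = {}\<close> by blast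
    \<comment> \<open>The translates supplied by the ideal are written with \<open>inv g\<close>, so
      the inverse of the element found is the witness.\<close>
    then show ?thesis by (intro bexI[of _ "inv g"]) auto
  qed
  have "open {x. N (s (inv g) x) \<noteq> 0}" if "g \<in> carrier G" for g
    by (rule open_Collect_neq[OF cont[OF inv_closed[OF that]] continuous_on_const])
  moreover have "UNIV \<subseteq> (\<Union>g\<in>carrier G. {x. N (s (inv g) x) \<noteq> 0})"
    using ex by blast
  ultimately obtain T where T: "T \<subseteq> carrier G" "finite T" "UNIV \<subseteq> (\<Union>g\<in>T. {x. N (s (inv g) x) \<noteq> 0})"
    by (rule compactE_image[OF compact_UNIV])

  define H where "H = (\<lambda>x. \<Sum>g\<in>T. N (s (inv g) x))"
  have Hc: "continuous_on UNIV H"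
    unfolding H_def using T(1) by (intro continuous_on_sum cont inv_closed) auto
  have H0: "H x \<noteq> 0" for x
  proof -
    obtain g where "g \<in> T" "N (s (inv g) x) \<noteq> 0" using T(3) by auto
    \<comment> \<open>All summands are squared norms, hence nonnegative, and the one at
      \<open>g\<close> is nonzero, so nothing cancels.\<close>
    then have "H x > 0"
      unfolding H_def N_def using T(2) cd_normsq_nonneg
      by (intro sum_pos2[where i = g]) (auto simp: less_le)
    then show ?thesis by simp
  qed
  have HI: "single \<one> (\<lambda>x. cd_real (H x)) \<in> I"
    unfolding H_def using T(2,1)
  proof (induction T rule: finite_induct)
    case empty
    then show ?case using zero_closed by (simp add: single_def)
  next
    case (insert g T)
    have "single \<one> (\<lambda>x. cd_real (\<Sum>g\<in>insert g T. N (s (inv g) x))) =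
      add R (single \<one> (\<lambda>x. cd_real (N (s (inv g) x)))) (single \<one> (\<lambda>x. cd_real (\<Sum>g\<in>T. N (s (inv g) x))))"
      using insert(1,2) by (auto simp: single_def cd_real_def fun_eq_iff)
    moreover have "\<dots> \<in> I"
      using insert NgI[of g] by (intro a_closed) auto
    ultimately show ?case by simp
  qed
  \<comment> \<open>The reciprocal of \<open>H\<close> is continuous and real-valued; multiplying by
    it puts \<open>u\<^sub>1\<close> into the ideal.\<close>
  have iH: "(\<lambda>x. cd_real (1 / H x)) \<in> carrier B"
    using H0 by (intro real_in_B continuous_intros Hc) auto
  have "cd_mult i (cd_real (H x)) (cd_real (1 / H x)) = cd_real 1" for x
    unfolding cd_mult_real(1) using H0[of x] by (auto simp: cd_real_def)
  then have "single \<one> (\<lambda>x. cd_real 1) \<in> I"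
    using ideal(2)[OF HI single_in_R[OF one_closed iH]]
    by (simp add: mult_single_single[OF real_in_B[OF Hc] iH])
  then have "X \<in> I" if "X \<in> carrier R" for X
    using ideal(1)[of "single \<one> (\<lambda>x. cd_real 1)" X] that by (simp only: mult_one_right)
  then show ?thesis using a_subset by blast
qed

lemma minimal_faithful_imp_simple:
  assumes min: "minimal_system G s" and faith: "faithful_system G s"
  shows "simple_nonassoc_ring R"
  unfolding simple_nonassoc_ring_def
proof (intro allI impI)
  fix I assume I: "two_sided_ideal I R"
  have IR: "I \<subseteq> carrier R" and z: "(\<lambda>g x k. 0) \<in> I"
    and ideal: "\<And>F X. F \<in> I \<Longrightarrow> X \<in> carrier R \<Longrightarrow> mult R F X \<in> I"
    using I additive_subgroup.zero_closed[of I R]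
    by (auto simp: two_sided_ideal_def additive_subgroup.a_subset)
  show "I = {\<zero>\<^bsub>R\<^esub>} \<or> I = carrier R"
  proof (cases "I = {\<zero>\<^bsub>R\<^esub>}")
    case False
    then obtain F where F: "F \<in> I" "F \<noteq> (\<lambda>g x k. 0)"
      using z by auto
    then obtain h z where hz: "F h z \<noteq> (\<lambda>k. 0)"
      by (auto simp: fun_eq_iff)
    have FR: "F \<in> carrier R" using F IR by blast
    have h: "h \<in> carrier G" using hz FR by (auto simp: in_carrier_R)
    \<comment> \<open>Right multiplication by the monomial at \<open>inv h\<close> carries the
      coefficient at \<open>h\<close> to \<open>\<one>\<close> unchanged, so \<open>F'\<close> is
      nonzero at \<open>\<one>\<close> and the point \<open>z\<close>.\<close>
    define F' where "F' = mult R F (single (inv h) (\<lambda>x. cd_real 1))"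
    have F': "F' \<in> I" "F' \<in> carrier R"
      unfolding F'_def using ideal[OF F(1) single_in_R[OF inv_closed[OF h] one_in_B]] IR by auto
    have F'z: "F' \<one> z = F h z"
      unfolding F'_def mult_single_right[OF inv_closed[OF h] one_in_B FR one_closed]
      using h cd_mult_one(2)[OF in_B_support[OF coeff_in_B[OF FR]]] by simp
    \<comment> \<open>These are the finitely many indices whose coefficients the bump function has
      to remove; being different from \<open>\<one>\<close>, they and their inverses act without
      fixed points.\<close>
    let ?S = "{g. F' g \<noteq> (\<lambda>x k. 0)} - {\<one>}"
    have S: "finite ?S" "?S \<subseteq> carrier G"
      using finite_support[OF F'(2)] support_subset[OF F'(2)] by auto
    have free: "s (inv g) x \<noteq> x" if "g \<in> ?S" for g x
    proof (rule minimal_faithful_imp_free[OF min faith])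
      show "inv g \<in> carrier G" "inv g \<noteq> \<one>"
        using that S by (auto simp: subset_iff inv_eq_1_iff)
    qed
    have "\<exists>p::'x \<Rightarrow> real. continuous_on UNIV p \<and> p z = 1 \<and>
        (\<forall>g\<in>?S. \<forall>x. p x * p (s (inv g) x) = 0)"
      by (rule ex_bump_function[OF _ S]) (rule free)
    then obtain p :: "'x \<Rightarrow> real" where p: "continuous_on UNIV p" "p z = 1"
      "\<forall>g\<in>?S. \<forall>x. p x * p (s (inv g) x) = 0"
      by blast
    let ?f = "\<lambda>x j. p x * p x * F' \<one> x j"
    have "?f \<in> carrier B"
      using coeff_in_B[OF F'(2), of \<one>] p(1)
      by (auto simp: in_carrier_cd_functions intro!: continuous_on_mult)
    moreover have "single \<one> ?f \<in> I"
    proof (rule ideal_compress[OF I F'(1) p(1)])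
      fix g x assume "F' g \<noteq> (\<lambda>x k. 0)" "g \<noteq> \<one>"
      then have "g \<in> ?S" by simp
      then show "p x * p (s (inv g) x) = 0" by (rule p(3)[rule_format])
    qed
    moreover have "?f z \<noteq> (\<lambda>k. 0)"
      using p(2) hz F'z by simp
    ultimately have "I = carrier R"
      by (rule ideal_with_single_eq_carrier[OF min I])
    then show ?thesis ..
  qed simp
qed

end

theorem proposition3p28:
  fixes G :: "('g, 'm) monoid_scheme"
    and s :: "'g \<Rightarrow> 'x::t2_space \<Rightarrow> 'x"
    and i :: nat
  assumes "comm_group G"
    and "compact (UNIV :: 'x set)"
    and "s \<in> hom G homeo_group"
  shows "simple_nonassoc_ring (skew_group_ring (cd_functions i) G (induced_action G s))
           \<longleftrightarrow> minimal_system G s \<and> faithful_system G s"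
proof -
  interpret comm_group G by fact
  interpret cd_system G s i
    by unfold_locales fact+
  show ?thesis
    using simple_imp_minimal simple_imp_faithful minimal_faithful_imp_simple by blast
qed

end
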